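(* Let $\mathbb{F}$ be a field of characteristic zero and let $A,B\in M_n(\mathbb{F})$. Then there exist positive integers $k_1,k_2$ such that $$\mathrm{Ker}\,\mathrm{ad}_A^{k_1}=\mathrm{Ann}_{k_1}(B)\quad\text{and}\quad \mathrm{Ker}\,\mathrm{ad}_B^{k_2}=\mathrm{Ann}_{k_2}(A)$$ if and only if $A$ and $B$ are polynomial equivalent over $\mathbb{F}$.
   Context: $M_n(\mathbb{F})$ is the algebra of $n\times n$ matrices over $\mathbb{F}$. For $A\in M_n(\mathbb{F})$, $\mathrm{ad}_A:M_n(\mathbb{F})\to M_n(\mathbb{F})$ is the linear map $\mathrm{ad}_A(X)=AX-XA$, and $\mathrm{ad}_A^k$ is its $k$-fold composition. Its kernel is $\mathrm{Ker}\,\mathrm{ad}_A^k=\{X\in M_n(\mathbb{F})\mid \mathrm{ad}_A^k(X)=O\}=\{X\mid \sum_{i=0}^k\binom{k}{i}(-1)^iA^{k-i}XA^i=O\}$. For $B\in M_n(\mathbb{F})$ the $k$-th annihilator of $B$ is $\mathrm{Ann}_k(B)=\{X\in M_n(\mathbb{F})\mid \mathrm{ad}_X^k(B)=O\}=\{X\mid \sum_{i=0}^k\binom{k}{i}(-1)^iX^{k-i}BX^i=O\}$. Matrices $A,B\in M_n(\mathbb{F})$ are polynomial equivalent over $\mathbb{F}$ if there exist $f(x),g(x)\in\mathbb{F}[x]$ with $A=f(B)$ and $B=g(A)$. *)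

theory Defs
  imports
    "Jordan_Normal_Form.Matrix"
    "HOL-Computational_Algebra.Polynomial"
begin

text \<open>
  The algebra of n-by-n matrices over a field is \<open>carrier_mat n n\<close>; as a ring structure it is
  \<open>ring_mat TYPE('a) n ()\<close>. The dimension \<open>n\<close> is an explicit argument where the carrier, the
  identity or the zero matrix is needed. All notions below are meant for matrices in this carrier.
\<close>

definition ad :: "'a :: ring_1 mat \<Rightarrow> 'a mat \<Rightarrow> 'a mat" where
  "ad A X = A * X - X * A"

definition ker_ad :: "nat \<Rightarrow> nat \<Rightarrow> 'a :: ring_1 mat \<Rightarrow> 'a mat set" where
  "ker_ad n k A = {X \<in> carrier_mat n n. (ad A ^^ k) X = 0\<^sub>m n n}"

text \<open>Here the variable matrix is the subscript of \<open>ad\<close>, so this set is in general not a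
  subspace.\<close>

definition Ann :: "nat \<Rightarrow> nat \<Rightarrow> 'a :: ring_1 mat \<Rightarrow> 'a mat set" where
  "Ann n k B = {X \<in> carrier_mat n n. (ad X ^^ k) B = 0\<^sub>m n n}"

text \<open>The value \<open>p(A)\<close>; the constant coefficient is multiplied by \<open>A ^\<^sub>m 0 = 1\<^sub>m n\<close>.\<close>

definition mat_poly_eval :: "nat \<Rightarrow> 'a :: comm_ring_1 poly \<Rightarrow> 'a mat \<Rightarrow> 'a mat" where
  "mat_poly_eval n p A =
     finsum (ring_mat TYPE('a) n ()) (\<lambda>i. coeff p i \<cdot>\<^sub>m (A ^\<^sub>m i)) {..degree p}"

definition poly_equivalent :: "nat \<Rightarrow> 'a :: comm_ring_1 mat \<Rightarrow> 'a mat \<Rightarrow> bool" where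
  "poly_equivalent n A B \<longleftrightarrow>
     (\<exists>f g. A = mat_poly_eval n f B \<and> B = mat_poly_eval n g A)"

end

theory Submission
  imports Defs "HOL-Library.Function_Algebras"
begin

text \<open>
  If \<open>A\<close> and \<open>B\<close> are polynomials in each other, they commute with the same matrices, and
  \<open>k\<^sub>1 = k\<^sub>2 = 1\<close> works. For the converse it is enough to show that \<open>A\<close> and \<open>B\<close> have the same
  centralizer: a matrix that commutes with the whole centralizer of \<open>A\<close> is a polynomial in \<open>A\<close>
  (lemma \<open>double_centralizer\<close>). If one of the exponents is \<open>1\<close>, its equation says just
  that the centralizers are equal. The point for larger exponents is that \<open>Ker ad\<^sub>A\<^sup>k\<close> is a linear subspace, whereas \<open>Ann\<^sub>k(B)\<close> is defined by
  equations of degree \<open>k\<close> in its elements and need not be closed under addition.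

  \<^item> Exponent at least \<open>3\<close>. If \<open>X\<^sup>2 = 0\<close> then \<open>ad\<^sub>X\<^sup>3 = 0\<close>, so \<open>Ann\<^sub>k(B)\<close> contains every
    square-zero matrix. These span the trace-zero matrices, and the identity lies in
    \<open>Ker ad\<^sub>A\<^sup>k\<close>; in characteristic zero the subspace is therefore everything. But for an
    idempotent \<open>F\<close> already \<open>ad\<^sub>F\<^sup>k(B) = 0\<close> forces \<open>F\<close> and \<open>B\<close> to commute, so \<open>B\<close> is central. Then
    \<open>Ker ad\<^sub>B\<^sup>l\<close> is everything for each \<open>l > 0\<close>, and the same argument with the other equation
    makes \<open>A\<close> central.

  \<^item> Both exponents equal to \<open>2\<close>. Adding \<open>B\<close> to an element of \<open>Ann\<^sub>2(B)\<close> shows that all four sets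
    of the hypothesis coincide, so that \<open>Ker ad\<^sub>A\<^sup>2 = Ann\<^sub>2(A)\<close>. This one-matrix condition gives
    \<open>Ker ad\<^sub>A\<^sup>2 = Ker ad\<^sub>A\<close> (lemma \<open>commute_if_ad_ad_eq_0\<close>), and the same for \<open>B\<close>; hence the
    centralizers agree. To prove it, let \<open>X\<close> be in \<open>Ker ad\<^sub>A\<^sup>2\<close> with \<open>N = [X,A] \<noteq> 0\<close>. Well-chosen
    elements of one of the two sets, tested against the defining equation of the other, give in
    turn \<open>N\<^sup>2 = 0\<close>, that \<open>A\<close> acts on \<open>N\<close> as a scalar (which may be taken to be \<open>0\<close>), \<open>A\<^sup>3 = 0\<close>,
    \<open>A\<^sup>2 = 0\<close>, and finally \<open>A = 0\<close>, against \<open>N \<noteq> 0\<close>.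
\<close>

section \<open>Calculus of square matrices and matrix units\<close>

context
  fixes n :: nat
begin

abbreviation Mn :: "'a mat set" where "Mn \<equiv> carrier_mat n n"

text \<open>
  Identities between noncommutative polynomials in square matrices are proved below in one way:
  expand both sides into sums of right-associated monomials and compare entries, where the
  monomials are opaque scalars. This is why the unfolding of an entry of a product is switched off
  in these proofs.
\<close>

lemma square_mat_eqI:
  assumes "A \<in> Mn" "B \<in> Mn" "\<And>i j. i < n \<Longrightarrow> j < n \<Longrightarrow> A $$ (i,j) = B $$ (i,j)"
  shows "A = B"
  using assms by (intro eq_matI) auto

lemma square_carrier:
  fixes A B :: "'a :: ring_1 mat"
  shows "A \<in> Mn \<Longrightarrow> B \<in> Mn \<Longrightarrow> A + B \<in> Mn" "A \<in> Mn \<Longrightarrow> B \<in> Mn \<Longrightarrow> A - B \<in> Mn"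
    "A \<in> Mn \<Longrightarrow> B \<in> Mn \<Longrightarrow> A * B \<in> Mn" "A \<in> Mn \<Longrightarrow> c \<cdot>\<^sub>m A \<in> Mn"
    "(1\<^sub>m n :: 'a mat) \<in> Mn" "(0\<^sub>m n n :: 'a mat) \<in> Mn" "A \<in> Mn \<Longrightarrow> B \<in> Mn \<Longrightarrow> ad A B \<in> Mn"
  by (auto simp: ad_def minus_carrier_mat)

lemma square_distrib:
  fixes A B C :: "'a :: comm_ring_1 mat"
  assumes "A \<in> Mn" "B \<in> Mn"
  shows "C \<in> Mn \<Longrightarrow> A * (B + C) = A * B + A * C" "C \<in> Mn \<Longrightarrow> (A + B) * C = A * C + B * C"
    "C \<in> Mn \<Longrightarrow> A * (B - C) = A * B - A * C" "C \<in> Mn \<Longrightarrow> (A - B) * C = A * C - B * C"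
    "C \<in> Mn \<Longrightarrow> A * B * C = A * (B * C)"
    "A * (c \<cdot>\<^sub>m B) = c \<cdot>\<^sub>m (A * B)" "(c \<cdot>\<^sub>m A) * B = c \<cdot>\<^sub>m (A * B)"
    "A * 1\<^sub>m n = A" "1\<^sub>m n * A = A" "A * 0\<^sub>m n n = 0\<^sub>m n n" "0\<^sub>m n n * A = 0\<^sub>m n n"
  using assms
  by (auto simp: mult_add_distrib_mat add_mult_distrib_mat mult_minus_distrib_mat
      minus_mult_distrib_mat mult_smult_distrib mult_smult_assoc_mat)

lemma square_zero:
  fixes A :: "'a :: comm_ring_1 mat"
  assumes "A \<in> Mn"
  shows "A - A = 0\<^sub>m n n" "A - 0\<^sub>m n n = A" "A + 0\<^sub>m n n = A" "0\<^sub>m n n + A = A"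
  using assms by auto

lemma zero_smult:
  fixes A :: "'a :: comm_ring_1 mat"
  shows "A \<in> Mn \<Longrightarrow> 0 \<cdot>\<^sub>m A = 0\<^sub>m n n"
  by (intro eq_matI) auto

lemma square_entries:
  fixes A B :: "'a :: comm_ring_1 mat"
  assumes "A \<in> Mn" "B \<in> Mn" "i < n" "j < n"
  shows "(A + B) $$ (i,j) = A $$ (i,j) + B $$ (i,j)" "(A - B) $$ (i,j) = A $$ (i,j) - B $$ (i,j)"
    "(c \<cdot>\<^sub>m A) $$ (i,j) = c * A $$ (i,j)"
    "(0\<^sub>m n n :: 'a mat) $$ (i,j) = 0"
  using assms by auto

lemma diff_eq_0_iff:
  fixes A B :: "'a :: comm_ring_1 mat"
  assumes "A \<in> Mn" "B \<in> Mn"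
  shows "A - B = 0\<^sub>m n n \<longleftrightarrow> A = B"
proof
  assume eq: "A - B = 0\<^sub>m n n"
  show "A = B"
  proof (rule square_mat_eqI[OF assms])
    fix i j assume "i < n" "j < n"
    with arg_cong[OF eq, of "\<lambda>M. M $$ (i,j)"] assms show "A $$ (i,j) = B $$ (i,j)"
      by (simp add: square_entries)
  qed
qed (use assms in simp)

lemma smult_cancel:
  fixes A B :: "'a :: field mat"
  assumes "c \<noteq> 0" "c \<cdot>\<^sub>m A = 0\<^sub>m n n" "A \<in> Mn"
  shows "A = 0\<^sub>m n n"
proof (rule square_mat_eqI)
  fix i j assume ij: "i < n" "j < n"
  have "(c \<cdot>\<^sub>m A) $$ (i,j) = 0" unfolding assms(2) using ij by simp
  then show "A $$ (i,j) = (0\<^sub>m n n :: 'a mat) $$ (i,j)" using assms(1,3) ij by simp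
qed (use assms in auto)

lemmas square_simps = square_carrier square_distrib

definition munit :: "nat \<Rightarrow> nat \<Rightarrow> 'a :: comm_ring_1 mat" where
  "munit j k = mat n n (\<lambda>(p,q). if p = j \<and> q = k then 1 else 0)"

lemma munit_carrier [simp]: "munit j k \<in> Mn"
  by (simp add: munit_def)

lemma munit_index: "p < n \<Longrightarrow> q < n \<Longrightarrow> munit j k $$ (p,q) = (if p = j \<and> q = k then 1 else 0)"
  by (simp add: munit_def)

lemma mult_entry:
  assumes "A \<in> Mn" "B \<in> Mn" "i < n" "j < n"
  shows "(A * B) $$ (i,j) = (\<Sum>r<n. A $$ (i,r) * B $$ (r,j))"
  using assms by (simp add: scalar_prod_def lessThan_atLeast0)

lemma mult_munit_entry:
  fixes P :: "'a :: comm_ring_1 mat"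
  assumes "P \<in> Mn" "j < n" "i < n" "l < n"
  shows "(P * munit j k) $$ (i,l) = (if l = k then P $$ (i,j) else 0)"
proof -
  have "(P * munit j k) $$ (i,l) = (\<Sum>r<n. if r = j then (if l = k then P $$ (i,j) else 0) else 0)"
    unfolding mult_entry[OF assms(1) munit_carrier assms(3,4)]
    by (rule sum.cong) (use assms in \<open>auto simp: munit_index\<close>)
  then show ?thesis using assms by (simp add: sum.delta)
qed

lemma mult_munit_mult_entry:
  fixes P R :: "'a :: comm_ring_1 mat"
  assumes "P \<in> Mn" "R \<in> Mn" "j < n" "k < n" "i < n" "l < n"
  shows "(P * munit j k * R) $$ (i,l) = P $$ (i,j) * R $$ (k,l)"
proof -
  have "(P * munit j k * R) $$ (i,l) = (\<Sum>r<n. if r = k then P $$ (i,j) * R $$ (k,l) else 0)"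
    unfolding mult_entry[OF mult_carrier_mat[OF assms(1) munit_carrier] assms(2,5,6)]
    by (rule sum.cong) (use assms in \<open>auto simp: mult_munit_entry\<close>)
  then show ?thesis using assms by (simp add: sum.delta)
qed

text \<open>
  Sandwiching by matrix units extracts an entry as a scalar; this makes products of the form
  \<open>E M E\<close> play the part of the bilinear form \<open>v\<^sup>T M u\<close> for rank-one matrices \<open>u v\<^sup>T\<close>.
\<close>

lemma munit_mult_munit:
  fixes M :: "'a :: comm_ring_1 mat"
  assumes "M \<in> Mn" "j < n" "k < n" "l < n" "m < n"
  shows "munit j k * M * munit l m = M $$ (k,l) \<cdot>\<^sub>m munit j m"
proof (rule square_mat_eqI)
  fix p q assume pq: "p < n" "q < n"
  have "(munit j k * M * munit l m) $$ (p,q) = (if q = m then (munit j k * M) $$ (p,l) else 0)"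
    using assms pq by (simp add: mult_munit_entry square_carrier)
  also have "(munit j k * M) $$ (p,l) = (1\<^sub>m n * munit j k * M) $$ (p,l)"
    using assms(1) by (simp add: left_mult_one_mat[OF munit_carrier])
  also have "\<dots> = 1\<^sub>m n $$ (p,j) * M $$ (k,l)"
    using assms pq by (intro mult_munit_mult_entry) (auto simp: square_carrier)
  finally show "(munit j k * M * munit l m) $$ (p,q) = (M $$ (k,l) \<cdot>\<^sub>m munit j m) $$ (p,q)"
    using assms pq by (simp add: munit_index square_entries)
qed (use assms in \<open>auto simp: square_carrier\<close>)

lemma munit_mult:
  assumes "j < n" "k < n" "l < n" "m < n"
  shows "munit j k * munit l m = (if k = l then munit j m else (0\<^sub>m n n :: 'a :: comm_ring_1 mat))"
proof -
  have "munit j k * munit l m = munit j k * 1\<^sub>m n * (munit l m :: 'a mat)"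
    by (simp add: right_mult_one_mat[OF munit_carrier])
  also have "\<dots> = 1\<^sub>m n $$ (k,l) \<cdot>\<^sub>m munit j m"
    by (rule munit_mult_munit) (use assms in auto)
  finally have "munit j k * munit l m = (1\<^sub>m n $$ (k,l) \<cdot>\<^sub>m munit j m :: 'a mat)" .
  then show ?thesis using assms zero_smult[of "munit j m"]
    by (auto intro: eq_matI)
qed

lemma nonzero_entry:
  assumes "A \<in> Mn" "A \<noteq> 0\<^sub>m n n"
  obtains i j where "i < n" "j < n" "A $$ (i,j) \<noteq> 0"
  using square_mat_eqI[OF assms(1) zero_carrier_mat] assms by fastforce

lemma mult_arbitrary_mult_eq_0:
  fixes P R :: "'a :: idom mat"
  assumes "P \<in> Mn" "R \<in> Mn" "\<And>Z. Z \<in> Mn \<Longrightarrow> P * Z * R = 0\<^sub>m n n" and P: "P \<noteq> 0\<^sub>m n n"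
  shows "R = 0\<^sub>m n n"
proof (rule ccontr)
  assume R: "R \<noteq> 0\<^sub>m n n"
  obtain i j where ij: "i < n" "j < n" "P $$ (i,j) \<noteq> 0" using nonzero_entry[OF assms(1) P] .
  obtain k l where kl: "k < n" "l < n" "R $$ (k,l) \<noteq> 0" using nonzero_entry[OF assms(2) R] .
  have "P $$ (i,j) * R $$ (k,l) = (P * munit j k * R) $$ (i,l)"
    using mult_munit_mult_entry[OF assms(1,2) ij(2) kl(1) ij(1) kl(2)] by simp
  also have "\<dots> = 0" using assms(3)[of "munit j k"] ij kl by simp
  finally show False using ij kl by simp
qed

section \<open>Iterated commutators\<close>

lemma ad_ad:
  fixes A :: "'a :: comm_ring_1 mat"
  assumes "A \<in> Mn" "X \<in> Mn"
  shows "ad A (ad A X) = A * A * X - 2 \<cdot>\<^sub>m (A * X * A) + X * A * A"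
  using assms unfolding ad_def
  by (intro square_mat_eqI) (simp_all add: square_simps square_entries del: index_mult_mat)

lemma ad_eq_0_iff:
  fixes A B :: "'a :: comm_ring_1 mat"
  assumes "A \<in> Mn" "B \<in> Mn"
  shows "ad A B = 0\<^sub>m n n \<longleftrightarrow> A * B = B * A"
  unfolding ad_def using assms by (simp add: diff_eq_0_iff square_carrier)

lemma ad_ad_eq_diff:
  fixes A X :: "'a :: comm_ring_1 mat"
  assumes "A \<in> Mn" "X \<in> Mn"
  shows "ad A (ad A X) = ad X A * A - A * ad X A"
  using assms unfolding ad_def
  by (intro square_mat_eqI) (simp_all add: square_simps square_entries del: index_mult_mat)

lemma ad_shift:
  fixes A X :: "'a :: comm_ring_1 mat"
  assumes "A \<in> Mn" "X \<in> Mn"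
  shows "ad (A - c \<cdot>\<^sub>m 1\<^sub>m n) X = ad A X" "ad X (A - c \<cdot>\<^sub>m 1\<^sub>m n) = ad X A"
  using assms unfolding ad_def
  by (auto intro!: square_mat_eqI simp: square_simps square_entries simp del: index_mult_mat)

lemma ad_ad_eq_0_if_square_0:
  fixes A Y :: "'a :: comm_ring_1 mat"
  assumes "A \<in> Mn" "Y \<in> Mn" "Y * Y = 0\<^sub>m n n" "Y * A * Y = 0\<^sub>m n n"
  shows "ad Y (ad Y A) = 0\<^sub>m n n"
proof -
  have "A * Y * Y = A * (Y * Y)" using assms(1,2) by (simp add: square_simps)
  then show ?thesis unfolding ad_ad[OF assms(2,1)] assms(3,4) using assms(1,2)
    by (simp add: assms(3) square_simps)
qed

lemma ad_pow_carrier: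
  fixes A X :: "'a :: ring_1 mat"
  shows "A \<in> Mn \<Longrightarrow> X \<in> Mn \<Longrightarrow> (ad A ^^ k) X \<in> Mn"
  by (induction k) (auto intro: square_carrier)

lemma ad_pow_add:
  fixes A X Y :: "'a :: comm_ring_1 mat"
  assumes "A \<in> Mn" "X \<in> Mn" "Y \<in> Mn"
  shows "(ad A ^^ k) (X + Y) = (ad A ^^ k) X + (ad A ^^ k) Y"
proof (induction k)
  case (Suc k)
  have "ad A (P + Q) = ad A P + ad A Q" if "P \<in> Mn" "Q \<in> Mn" for P Q
    using that assms(1) unfolding ad_def
    by (intro square_mat_eqI) (simp_all add: square_simps square_entries del: index_mult_mat)
  then show ?case using Suc assms by (simp add: ad_pow_carrier)
qed simp

lemma ad_pow_zero:
  fixes A :: "'a :: comm_ring_1 mat"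
  assumes "A \<in> Mn"
  shows "(ad A ^^ k) (0\<^sub>m n n) = 0\<^sub>m n n"
  by (induction k) (use assms in \<open>auto simp: ad_def\<close>)

lemma ad_pow_eq_0_if_commute:
  fixes A X :: "'a :: comm_ring_1 mat"
  assumes "A \<in> Mn" "X \<in> Mn" "A * X = X * A" "k > 0"
  shows "(ad A ^^ k) X = 0\<^sub>m n n"
proof -
  obtain m where "k = Suc m" using assms(4) gr0_implies_Suc by blast
  moreover have "ad A X = 0\<^sub>m n n" using assms by (simp add: ad_eq_0_iff)
  ultimately show ?thesis using assms ad_pow_zero by (simp add: funpow_Suc_right del: funpow.simps)
qed

section \<open>Exponents at least three\<close>

text \<open>
  The map \<open>ad F\<close> is diagonalizable with eigenvalues \<open>0\<close>, \<open>1\<close> and \<open>-1\<close>, so its powers have the same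
  kernel as \<open>ad F\<close> itself.
\<close>

lemma commute_if_ad_idempotent_pow_0:
  fixes F B :: "'a :: comm_ring_1 mat"
  assumes F: "F \<in> Mn" and B: "B \<in> Mn" and idem: "F * F = F"
    and "(ad F ^^ k) B = 0\<^sub>m n n"
  shows "F * B = B * F"
  using B assms(4)
proof (induction k arbitrary: B)
  case 0
  then show ?case using F by simp
next
  case (Suc k)
  note B = \<open>B \<in> Mn\<close>
  have FF: "F * (F * Z) = F * Z" if "Z \<in> Mn" for Z
    using F that idem by (metis assoc_mult_mat)
  have "(ad F ^^ k) (ad F B) = 0\<^sub>m n n"
    using Suc.prems by (simp add: funpow_Suc_right del: funpow.simps)
  then have "F * ad F B = ad F B * F"
    using Suc.IH[of "ad F B"] F B by (simp add: square_carrier)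
  then have eq: "F * B - F * (B * F) = F * (B * F) - B * F"
    using F B unfolding ad_def by (simp add: square_simps FF idem)
  have "F * (F * B - F * (B * F)) = F * (F * (B * F) - B * F)" by (simp only: eq)
  then have 1: "F * B - F * (B * F) = 0\<^sub>m n n"
    using F B by (simp add: square_simps square_zero FF)
  have "F * (B * F) - B * F = 0\<^sub>m n n" using eq 1 by simp
  then show ?case using 1 F B by (simp add: diff_eq_0_iff square_carrier)
qed

lemma ad_pow_eq_0_if_square_0:
  fixes X B :: "'a :: comm_ring_1 mat"
  assumes X: "X \<in> Mn" and B: "B \<in> Mn" and sq: "X * X = 0\<^sub>m n n" and k: "k \<ge> 3"
  shows "(ad X ^^ k) B = 0\<^sub>m n n"
proof -
  have XX: "X * (X * Z) = 0\<^sub>m n n" if "Z \<in> Mn" for Z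
    using X that sq by (metis assoc_mult_mat left_mult_zero_mat)
  have "ad X (ad X (ad X B)) = 0\<^sub>m n n"
    using X B unfolding ad_def
    by (intro square_mat_eqI) (simp_all add: square_simps square_entries XX sq del: index_mult_mat)
  then have 3: "(ad X ^^ 3) B = 0\<^sub>m n n" by (simp add: eval_nat_numeral)
  have "(ad X ^^ k) B = (ad X ^^ (k - 3 + 3)) B" using k by simp
  also have "\<dots> = (ad X ^^ (k - 3)) ((ad X ^^ 3) B)" by (simp only: funpow_add o_apply)
  finally show ?thesis using 3 X by (simp add: ad_pow_zero)
qed

text \<open>
  The idempotents \<open>E\<^sub>i\<^sub>i\<close> and \<open>E\<^sub>i\<^sub>i + E\<^sub>i\<^sub>j\<close> span all matrices; commuting with the matrix units
  makes \<open>B\<close> a scalar matrix.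
\<close>

lemma central_if_commute_idempotents:
  fixes B X :: "'a :: comm_ring_1 mat"
  assumes B: "B \<in> Mn" and X: "X \<in> Mn"
    and idem: "\<And>i. i < n \<Longrightarrow> munit i i * B = B * munit i i"
      "\<And>i j. i < n \<Longrightarrow> j < n \<Longrightarrow> i \<noteq> j \<Longrightarrow> (munit i i + munit i j) * B = B * (munit i i + munit i j)"
  shows "X * B = B * X"
proof -
  have comm: "munit i j * B = B * munit i j" if ij: "i < n" "j < n" for i j
  proof (cases "i = j")
    case False
    have "munit i i * B + munit i j * B = munit i i * B + B * munit i j"
      using idem(1)[OF ij(1)] idem(2)[OF ij False] B by (simp add: square_simps)
    then have eq: "(munit i i * B + munit i j * B) $$ p = (munit i i * B + B * munit i j) $$ p" for p by simp
    show ?thesis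
    proof (rule square_mat_eqI)
      fix p q assume "p < n" "q < n"
      then show "(munit i j * B) $$ (p,q) = (B * munit i j) $$ (p,q)"
        using eq[of "(p,q)"] B by (simp add: square_carrier square_entries del: index_mult_mat)
    qed (use B in \<open>simp_all add: square_carrier\<close>)
  qed (use idem(1) ij in simp)
  have entry: "B $$ (j,q) = (if q = j then B $$ (i,i) else 0)" if "i < n" "j < n" "q < n" for i j q
  proof -
    have "(1\<^sub>m n * munit i j * B) $$ (i,q) = 1\<^sub>m n $$ (i,i) * B $$ (j,q)"
      using that B by (intro mult_munit_mult_entry) auto
    then have "B $$ (j,q) = (munit i j * B) $$ (i,q)"
      using that B by (simp add: left_mult_one_mat[OF munit_carrier])
    also have "\<dots> = (B * munit i j) $$ (i,q)" using comm that by simp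
    finally show ?thesis using that B by (simp add: mult_munit_entry)
  qed
  define b where "b = B $$ (0,0)"
  have "B = b \<cdot>\<^sub>m 1\<^sub>m n"
  proof (rule square_mat_eqI)
    fix p q assume "p < n" "q < n"
    then show "B $$ (p,q) = (b \<cdot>\<^sub>m 1\<^sub>m n) $$ (p,q)"
      using entry[of 0 p q] unfolding b_def[symmetric] by (cases "p = q") simp_all
  qed (use B in \<open>simp_all add: square_carrier\<close>)
  then show ?thesis using X by (simp add: square_distrib square_carrier)
qed

text \<open>
  A linear map that vanishes on square-zero matrices takes the same value on all \<open>E\<^sub>i\<^sub>i\<close>, because it
  vanishes on \<open>E\<^sub>i\<^sub>j\<close> for distinct \<open>i\<close> and \<open>j\<close> and because \<open>E\<^sub>i\<^sub>i - E\<^sub>j\<^sub>j\<close> differs from a square-zero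
  matrix by such terms. So its value at the identity is \<open>n\<close> times its value at \<open>E\<^sub>i\<^sub>i\<close>, and
  \<open>ad A\<close> vanishes at the identity.
\<close>

lemma ad_pow_diag_munit_eq_0:
  fixes A :: "'a :: field_char_0 mat"
  assumes A: "A \<in> Mn" and k: "k > 0" and i: "i < n"
    and sq: "\<And>X. X \<in> Mn \<Longrightarrow> X * X = 0\<^sub>m n n \<Longrightarrow> (ad A ^^ k) X = 0\<^sub>m n n"
  shows "(ad A ^^ k) (munit i i) = 0\<^sub>m n n"
proof -
  define D where "D = ad A ^^ k"
  have D: "D X \<in> Mn" if "X \<in> Mn" for X using A that by (simp add: D_def ad_pow_carrier)
  have add: "D (X + Y) = D X + D Y" if "X \<in> Mn" "Y \<in> Mn" for X Y
    using A that by (simp add: D_def ad_pow_add)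
  have off: "D (munit i j) = 0\<^sub>m n n" if "i < n" "j < n" "i \<noteq> j" for i j
    unfolding D_def by (rule sq) (use that in \<open>auto simp: munit_mult\<close>)
  have diag: "D (munit i i) = D (munit j j)" if ij: "i < n" "j < n" "i \<noteq> j" for i j
  proof -
    \<comment> \<open>On the indices \<open>i\<close> and \<open>j\<close>, the matrix \<open>?P - ?Q\<close> has the rows \<open>(1,-1)\<close> and \<open>(1,-1)\<close>.\<close>
    let ?P = "munit i i + munit j i :: 'a mat" and ?Q = "munit i j + munit j j :: 'a mat"
    have G: "?P - ?Q \<in> Mn" by (simp add: square_carrier)
    have "(?P - ?Q) * (?P - ?Q) = 0\<^sub>m n n"
      using ij by (intro square_mat_eqI)
        (simp_all add: square_simps square_zero munit_mult square_entries munit_index)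
    with G have "D (?P - ?Q) = 0\<^sub>m n n" unfolding D_def by (rule sq)
    moreover have "?P = (?P - ?Q) + ?Q"
      by (intro square_mat_eqI) (simp_all add: square_carrier square_entries)
    then have "D ?P = D (?P - ?Q) + D ?Q" using add[of "?P - ?Q" ?Q] by (simp add: square_carrier)
    ultimately show ?thesis
      using ij off[of i j] off[of j i] D[of "munit i i"] D[of "munit j j"]
      by (simp add: add square_zero square_carrier)
  qed
  \<comment> \<open>the partial sums of the identity as a sum of diagonal matrix units\<close>
  define P :: "nat \<Rightarrow> 'a mat" where "P m = mat n n (\<lambda>(p,q). if p = q \<and> p < m then 1 else 0)" for m
  have P: "P m \<in> Mn" for m by (simp add: P_def)
  have DP: "D (P m) = of_nat m \<cdot>\<^sub>m D (munit i i)" if "m \<le> n" for m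
    using that
  proof (induction m)
    case 0
    have "P 0 = 0\<^sub>m n n" by (intro eq_matI) (auto simp: P_def)
    then show ?case using A D[of "munit i i"] by (simp add: D_def ad_pow_zero zero_smult)
  next
    case (Suc m)
    have "P (Suc m) = P m + munit m m"
      by (intro eq_matI) (auto simp: P_def munit_def)
    then have "D (P (Suc m)) = D (P m) + D (munit m m)" using P by (simp add: add)
    moreover have "D (munit m m) = D (munit i i)" using diag[of m i] Suc.prems i by auto
    ultimately show ?case using Suc D[of "munit i i"]
      by (intro square_mat_eqI) (simp_all add: square_carrier square_entries distrib_right)
  qed
  have "P n = 1\<^sub>m n" by (intro eq_matI) (auto simp: P_def)
  moreover have "D (1\<^sub>m n) = 0\<^sub>m n n"
    unfolding D_def by (rule ad_pow_eq_0_if_commute) (use A k in auto)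
  ultimately have "of_nat n \<cdot>\<^sub>m D (munit i i) = 0\<^sub>m n n" using DP[of n] by simp
  then have "D (munit i i) = 0\<^sub>m n n"
    by (rule smult_cancel[rotated]) (use i D in auto)
  then show ?thesis by (simp add: D_def)
qed

lemma central_if_ker_ad_eq_Ann_ge_3:
  fixes A B :: "'a :: field_char_0 mat"
  assumes A: "A \<in> Mn" and B: "B \<in> Mn" and eq: "ker_ad n k A = Ann n k B" and k: "k \<ge> 3"
    and X: "X \<in> Mn"
  shows "X * B = B * X"
proof -
  have sq: "(ad A ^^ k) X = 0\<^sub>m n n" if "X \<in> Mn" "X * X = 0\<^sub>m n n" for X
    using ad_pow_eq_0_if_square_0[OF that(1) B that(2) k] eq that(1) by (auto simp: ker_ad_def Ann_def)
  have diag: "(ad A ^^ k) (munit i i) = 0\<^sub>m n n" if "i < n" for i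
    by (rule ad_pow_diag_munit_eq_0[OF A _ that sq]) (use k in auto)
  have comm: "F * B = B * F" if "F \<in> Mn" "F * F = F" "(ad A ^^ k) F = 0\<^sub>m n n" for F
  proof -
    have "F \<in> Ann n k B" using that eq by (auto simp: ker_ad_def)
    then show ?thesis using commute_if_ad_idempotent_pow_0[OF that(1) B that(2)] by (auto simp: Ann_def)
  qed
  show ?thesis
  proof (rule central_if_commute_idempotents[OF B X])
    fix i assume i: "i < n"
    show "munit i i * B = B * munit i i"
      by (rule comm) (use i diag in \<open>auto simp: munit_mult\<close>)
    fix j assume j: "j < n" "i \<noteq> j"
    show "(munit i i + munit i j) * B = B * (munit i i + munit i j)"
    proof (rule comm)
      have "(ad A ^^ k) (munit i j) = 0\<^sub>m n n"
        by (rule sq) (use i j in \<open>auto simp: munit_mult\<close>)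
      then show "(ad A ^^ k) (munit i i + munit i j) = 0\<^sub>m n n"
        using A i diag by (simp add: ad_pow_add)
    qed (use i j in \<open>simp_all add: munit_mult square_distrib square_carrier square_zero\<close>)
  qed
qed

lemma central_if_Ann_all:
  fixes A :: "'a :: comm_ring_1 mat"
  assumes A: "A \<in> Mn" and Ann: "Ann n k A = Mn" and X: "X \<in> Mn"
  shows "X * A = A * X"
proof (rule central_if_commute_idempotents[OF A X])
  have comm: "F * A = A * F" if "F \<in> Mn" "F * F = F" for F
    using commute_if_ad_idempotent_pow_0[OF that(1) A that(2)] Ann that(1) by (auto simp: Ann_def)
  fix i assume i: "i < n"
  show "munit i i * A = A * munit i i"
    by (rule comm) (use i in \<open>auto simp: munit_mult\<close>)
  fix j assume j: "j < n" "i \<noteq> j"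
  show "(munit i i + munit i j) * A = A * (munit i i + munit i j)"
    by (rule comm) (use i j in \<open>simp_all add: munit_mult square_distrib square_carrier square_zero\<close>)
qed

section \<open>Exponent two\<close>

text \<open>
  The case \<open>B = A\<close>, \<open>k = 2\<close> of the hypothesis of the theorem, written without powers.
\<close>

definition ad2_symmetric :: "'a :: comm_ring_1 mat \<Rightarrow> bool" where
  "ad2_symmetric A \<longleftrightarrow>
     (\<forall>X \<in> Mn. ad A (ad A X) = 0\<^sub>m n n \<longleftrightarrow> ad X (ad X A) = 0\<^sub>m n n)"

lemma ad2_symmetric_shift:
  fixes A :: "'a :: comm_ring_1 mat"
  assumes "A \<in> Mn" "ad2_symmetric A"
  shows "ad2_symmetric (A - c \<cdot>\<^sub>m 1\<^sub>m n)"
  using assms unfolding ad2_symmetric_def by (simp add: ad_shift square_carrier)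

text \<open>
  The kernel of \<open>(ad A)\<^sup>2\<close> is closed under left multiplication by \<open>A\<close>, since \<open>ad A\<close> commutes with this
  multiplication. So \<open>A X\<close> satisfies the quadratic equation that defines the other set, and there
  \<open>[A X, [A X, A]]\<close> reduces to \<open>A [X,A]\<^sup>2\<close>.
\<close>

lemma ad2_symmetric_mult_square:
  fixes A X :: "'a :: comm_ring_1 mat"
  assumes A: "A \<in> Mn" and X: "X \<in> Mn" and sym: "ad2_symmetric A"
    and X2: "ad A (ad A X) = 0\<^sub>m n n"
  shows "A * (ad X A * ad X A) = 0\<^sub>m n n"
proof -
  define N where "N = ad X A"
  have N: "N \<in> Mn" using A X by (simp add: N_def square_carrier)
  have "ad X N = 0\<^sub>m n n" using sym X X2 by (simp add: ad2_symmetric_def N_def)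
  then have NX: "N * X = X * N" using X N by (simp add: ad_eq_0_iff)
  have NA: "N * A = A * N"
    using X2 A N X unfolding ad_ad_eq_diff[OF A X] by (simp add: diff_eq_0_iff square_carrier N_def)
  have 1: "ad A (A * X) = A * ad A X"
    using A X unfolding ad_def by (simp add: square_simps)
  have 2: "ad A (A * ad A X) = A * ad A (ad A X)"
    using A X unfolding ad_def[of A "ad A X"] ad_def[of A "A * ad A X"] by (simp add: square_simps)
  have "ad A (ad A (A * X)) = 0\<^sub>m n n"
    using A by (simp add: 1 2 X2)
  then have "ad (A * X) (ad (A * X) A) = 0\<^sub>m n n"
    using sym A X unfolding ad2_symmetric_def by (simp add: square_carrier)
  moreover have "ad (A * X) A = A * N"
    using A X unfolding N_def ad_def by (simp add: square_simps)
  moreover have "ad (A * X) (A * N) = A * (N * N)"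
  proof -
    have "A * N * (A * X) = A * (N * A) * X" using A X N by (simp add: square_simps)
    also have "\<dots> = A * A * (N * X)" using A X N by (simp add: NA square_simps)
    also have "\<dots> = A * A * X * N" using A X N by (simp add: NX square_simps)
    finally have "ad (A * X) (A * N) = A * (X * A - A * X) * N"
      using A X N unfolding ad_def by (simp add: square_simps)
    then show ?thesis using A X N by (simp add: ad_def[of X A, folded N_def] square_simps)
  qed
  ultimately show ?thesis unfolding N_def[symmetric] by simp
qed

text \<open>
  Compare \<open>A [X,A]\<^sup>2 = 0\<close> with the same equation for \<open>A - 1\<close>, which has the same commutators.
\<close>

lemma ad2_symmetric_square_0:
  fixes A X :: "'a :: comm_ring_1 mat"
  assumes A: "A \<in> Mn" and X: "X \<in> Mn" and sym: "ad2_symmetric A"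
    and X2: "ad A (ad A X) = 0\<^sub>m n n"
  shows "ad X A * ad X A = 0\<^sub>m n n"
proof -
  define N where "N = ad X A"
  have N: "N \<in> Mn" using A X by (simp add: N_def square_carrier)
  have 0: "A * (N * N) = 0\<^sub>m n n"
    using ad2_symmetric_mult_square[OF assms] by (simp add: N_def)
  have "(A - 1 \<cdot>\<^sub>m 1\<^sub>m n) * (N * N) = 0\<^sub>m n n"
    using ad2_symmetric_mult_square[OF _ X ad2_symmetric_shift[OF A sym, of 1]] A X X2
    by (simp add: ad_shift square_carrier N_def)
  moreover have "1 \<cdot>\<^sub>m (N * N) = N * N" by (intro eq_matI) auto
  ultimately have "0\<^sub>m n n - N * N = 0\<^sub>m n n"
    using A N 0 by (simp add: square_simps)
  then show ?thesis using N by (simp add: diff_eq_0_iff square_carrier N_def)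
qed

text \<open>
  The hypothesis says that the symmetric tensor \<open>Q N - 2 S S + N Q\<close> vanishes; unless \<open>N = 0\<close>,
  this forces \<open>S\<close> to be a multiple of \<open>N\<close>: eliminating \<open>Q\<close> by means of the diagonal equations leaves a perfect square.
\<close>

lemma proportional_if_quadratic:
  fixes N S Q :: "'i \<Rightarrow> 'a :: field"
  assumes eq: "\<And>p r. p \<in> I \<Longrightarrow> r \<in> I \<Longrightarrow> Q p * N r - 2 * (S p * S r) + N p * Q r = 0"
    and p: "p \<in> I" "N p \<noteq> 0" and r: "r \<in> I" and two: "(2 :: 'a) \<noteq> 0"
  shows "S r = S p / N p * N r"
proof -
  have pp: "Q p * N p = S p * S p" if "p \<in> I" for p
  proof -
    have "2 * (Q p * N p - S p * S p) = 0" using eq[OF that that] by (simp add: algebra_simps)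
    then show ?thesis using two by simp
  qed
  have "(S p * N r - N p * S r)\<^sup>2
      = (Q p * N r - 2 * (S p * S r) + N p * Q r) * N r * N p
        - N r * N r * (Q p * N p - S p * S p) - N p * N p * (Q r * N r - S r * S r)"
    by (simp add: power2_eq_square algebra_simps)
  also have "\<dots> = 0" using p r by (simp add: eq pp)
  finally show ?thesis using p by (simp add: field_simps)
qed

text \<open>
  For \<open>N = [X,A]\<close> and arbitrary \<open>Z\<close>, the matrix \<open>Y = N Z N\<close> satisfies \<open>Y\<^sup>2 = 0\<close> and \<open>Y A Y = 0\<close>, since
  \<open>N\<^sup>2 = 0\<close> and \<open>N\<close> commutes with \<open>A\<close>. So \<open>ad Y (ad Y A) = 0\<close>, and hence \<open>ad A (ad A Y) = 0\<close>. Read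
  entrywise with \<open>Z\<close> a matrix unit, the latter is the quadratic relation between \<open>N\<close>, \<open>N A\<close> and
  \<open>N A\<^sup>2\<close> of the preceding lemma.
\<close>

lemma ad2_symmetric_scalar_action:
  fixes A X :: "'a :: field_char_0 mat"
  assumes A: "A \<in> Mn" and X: "X \<in> Mn" and sym: "ad2_symmetric A"
    and X2: "ad A (ad A X) = 0\<^sub>m n n" and nz: "ad X A \<noteq> 0\<^sub>m n n"
  obtains c where "ad X A * (A - c \<cdot>\<^sub>m 1\<^sub>m n) = 0\<^sub>m n n" "(A - c \<cdot>\<^sub>m 1\<^sub>m n) * ad X A = 0\<^sub>m n n"
proof -
  define N where "N = ad X A"
  have N: "N \<in> Mn" using A X by (simp add: N_def square_carrier)
  have NN: "N * N = 0\<^sub>m n n" unfolding N_def by (rule ad2_symmetric_square_0[OF A X sym X2])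
  have NA: "N * A = A * N"
    using X2 A N X unfolding ad_ad_eq_diff[OF A X] by (simp add: diff_eq_0_iff square_carrier N_def)
  have AAN: "A * A * N = N * (A * A)"
  proof -
    have "A * A * N = A * (N * A)" using A N by (simp add: NA square_simps)
    also have "\<dots> = A * N * A" using A N by (simp add: square_simps)
    finally show ?thesis using A N by (simp add: NA[symmetric] square_simps)
  qed
  have eq: "(A * A * N) * Z * N - 2 \<cdot>\<^sub>m ((A * N) * Z * (N * A)) + N * Z * (N * A * A) = 0\<^sub>m n n"
    if Z: "Z \<in> Mn" for Z
  proof -
    let ?Y = "N * Z * N"
    have "?Y * ?Y = N * Z * (N * N) * Z * N" "?Y * A * ?Y = N * Z * (N * A) * N * Z * N"
      using A N Z by (simp_all add: square_simps)
    moreover have "N * Z * (N * A) * N * Z * N = N * Z * A * (N * N) * Z * N"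
      using A N Z by (simp add: NA square_simps)
    ultimately have "ad ?Y (ad ?Y A) = 0\<^sub>m n n"
      using A N Z by (intro ad_ad_eq_0_if_square_0) (simp_all add: NN square_carrier square_distrib(9-))
    then have "ad A (ad A ?Y) = 0\<^sub>m n n"
      using sym N Z unfolding ad2_symmetric_def by (simp add: square_carrier)
    then show ?thesis using A N Z by (simp add: ad_ad square_simps)
  qed
  obtain i0 j0 where ij: "i0 < n" "j0 < n" "N $$ (i0,j0) \<noteq> 0"
    using nonzero_entry[OF N] nz by (auto simp: N_def)
  let ?c = "(N * A) $$ (i0,j0) / N $$ (i0,j0)"
  have NA_entry: "(N * A) $$ r = ?c * N $$ r" if "r \<in> {..<n} \<times> {..<n}" for r
  proof (rule proportional_if_quadratic[where I = "{..<n} \<times> {..<n}" and Q = "\<lambda>r. (N * A * A) $$ r"])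
    fix p r assume "p \<in> {..<n} \<times> {..<n}" "r \<in> {..<n} \<times> {..<n}"
    then obtain i j k l where [simp]: "p = (i,j)" "r = (k,l)" and lt: "i < n" "j < n" "k < n" "l < n"
      by auto
    have NAA: "A * A * N = N * A * A" using A N by (simp add: AAN square_simps)
    have c: "N * A \<in> Mn" "N * A * A \<in> Mn" using A N by (auto simp: square_carrier)
    have "((N * A * A) * munit j k * N - 2 \<cdot>\<^sub>m ((N * A) * munit j k * (N * A))
        + N * munit j k * (N * A * A)) $$ (i,l) = 0"
      using eq[OF munit_carrier[of j k]] lt unfolding NAA NA[symmetric] by simp
    moreover have "(N * A * A) * munit j k * N \<in> Mn" "(N * A) * munit j k * (N * A) \<in> Mn"
      "N * munit j k * (N * A * A) \<in> Mn"
      using A N by (simp_all add: square_carrier del: assoc_mult_mat)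
    ultimately show "(N * A * A) $$ p * N $$ r - 2 * ((N * A) $$ p * (N * A) $$ r)
        + N $$ p * (N * A * A) $$ r = 0"
      using lt N c
      by (simp add: square_entries square_carrier mult_munit_mult_entry
          del: index_mult_mat assoc_mult_mat)
  qed (use ij that in auto)
  have "N * A = ?c \<cdot>\<^sub>m N"
    using A N NA_entry by (intro square_mat_eqI) (simp_all add: square_carrier square_entries del: index_mult_mat)
  moreover from this have "A * N = ?c \<cdot>\<^sub>m N" by (simp add: NA)
  ultimately have "N * (A - ?c \<cdot>\<^sub>m 1\<^sub>m n) = 0\<^sub>m n n" "(A - ?c \<cdot>\<^sub>m 1\<^sub>m n) * N = 0\<^sub>m n n"
    using A N by (simp_all add: square_distrib square_carrier)
  then show ?thesis using that unfolding N_def by blast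
qed

text \<open>
  Three families of test matrices \<open>Y\<close> are used, with \<open>N = [X,A]\<close> and \<open>E\<close> a matrix unit. First,
  \<open>Y = N Z A\<close> lies in \<open>Ann\<^sub>2(A)\<close>, and its membership in \<open>Ker ad\<^sub>A\<^sup>2\<close> reads \<open>N Z A\<^sup>3 = 0\<close>; so
  \<open>A\<^sup>3 = 0\<close>. If \<open>A\<^sup>2 \<noteq> 0\<close>, there is a nonzero \<open>Y = E (1 + a A + b A\<^sup>2)\<close> with \<open>Y\<^sup>2 = Y A Y = 0\<close> but
  \<open>Y A\<^sup>2 Y \<noteq> 0\<close>, which again lies in \<open>Ann\<^sub>2(A)\<close> but not in \<open>Ker ad\<^sub>A\<^sup>2\<close>. If \<open>A\<^sup>2 = 0\<close>, then
  idempotents \<open>Y = N E W\<close> lie in \<open>Ker ad\<^sub>A\<^sup>2\<close>, so they commute with \<open>A\<close>; as \<open>A Y = 0\<close>, this says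
  \<open>N E W A = 0\<close>, for enough matrices \<open>W\<close> to conclude \<open>A = 0\<close>.
\<close>

lemma ad2_symmetric_nilpotent_case:
  fixes A X :: "'a :: field mat"
  assumes A: "A \<in> Mn" and X: "X \<in> Mn" and sym: "ad2_symmetric A"
    and nz: "ad X A \<noteq> 0\<^sub>m n n"
    and NA: "ad X A * A = 0\<^sub>m n n" and AN: "A * ad X A = 0\<^sub>m n n"
  shows False
proof -
  define N where "N = ad X A"
  have N: "N \<in> Mn" using A X by (simp add: N_def square_carrier)
  have N0: "N \<noteq> 0\<^sub>m n n" "N * A = 0\<^sub>m n n" "A * N = 0\<^sub>m n n" using assms by (auto simp: N_def)
  have ANZ: "A * (N * Z) = 0\<^sub>m n n" if "Z \<in> Mn" for Z
  proof -
    have "A * (N * Z) = A * N * Z" using A N that by (simp add: square_simps)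
    then show ?thesis using that by (simp add: N0)
  qed
  have ad_ad_left0: "ad A (ad A Y) = Y * A * A" if "Y \<in> Mn" "A * Y = 0\<^sub>m n n" for Y
  proof -
    have "A * A * Y = A * (A * Y)" using A that by (simp add: square_simps)
    moreover have "A * Y * A = 0\<^sub>m n n" using A that by simp
    ultimately show ?thesis using A that by (simp add: ad_ad square_simps square_zero)
  qed
  have cube: "A * A * A = 0\<^sub>m n n"
  proof (rule mult_arbitrary_mult_eq_0[OF N _ _ N0(1)])
    fix Z :: "'a mat" assume Z: "Z \<in> Mn"
    let ?Y = "N * Z * A"
    have AY: "A * ?Y = 0\<^sub>m n n" using ANZ[of "Z * A"] A N Z by (simp add: square_simps)
    have Y: "?Y \<in> Mn" using A N Z by (simp add: square_carrier)
    have "?Y * ?Y = N * Z * (A * ?Y)" using A N Z by (simp add: square_simps)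
    moreover have "?Y * A * ?Y = ?Y * (A * ?Y)" using A Y by (simp add: square_simps)
    ultimately have "ad ?Y (ad ?Y A) = 0\<^sub>m n n"
      using A Y N Z unfolding AY by (intro ad_ad_eq_0_if_square_0) (simp_all add: square_carrier square_distrib(9-))
    then have "ad A (ad A ?Y) = 0\<^sub>m n n" using sym Y unfolding ad2_symmetric_def by simp
    then show "N * Z * (A * A * A) = 0\<^sub>m n n"
      using ad_ad_left0[OF Y AY] A N Z by (simp add: square_simps)
  qed (use A in \<open>simp add: square_carrier\<close>)
  show False
  proof (cases "A * A = 0\<^sub>m n n")
    case True
    obtain i j where ij: "i < n" "j < n" "N $$ (i,j) \<noteq> 0" using nonzero_entry[OF N N0(1)] .
    define E :: "'a mat" where "E = munit j i"
    have E: "E \<in> Mn" by (simp add: E_def)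
    have *: "N * E * (W * A) = 0\<^sub>m n n" if W: "W \<in> Mn" "(W * N) $$ (i,j) = 1" for W
    proof -
      let ?Y = "N * E * W"
      have Y: "?Y \<in> Mn" using N E W by (simp add: square_carrier)
      have AY: "A * ?Y = 0\<^sub>m n n" using ANZ[of "E * W"] N E W by (simp add: square_simps)
      have "?Y * ?Y = N * (E * (W * N) * E) * W" using N E W by (simp add: square_simps)
      also have "E * (W * N) * E = 1 \<cdot>\<^sub>m E"
        using munit_mult_munit[of "W * N" j i j i] ij N W by (simp add: E_def square_carrier)
      also have "1 \<cdot>\<^sub>m E = E" by (intro eq_matI) auto
      finally have YY: "?Y * ?Y = ?Y" .
      have YAY: "?Y * A * ?Y = ?Y * (A * ?Y)" using A Y by (simp add: square_simps)
      have AYY: "A * ?Y * ?Y = A * (?Y * ?Y)" using A Y by (simp add: square_simps)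
      have "?Y * A * A = 0\<^sub>m n n"
      proof -
        have "?Y * A * A = N * E * W * (A * A)" using A N E W by (simp add: square_simps)
        then show ?thesis using True N E W by (simp add: square_simps)
      qed
      then have "ad A (ad A ?Y) = 0\<^sub>m n n" using ad_ad_left0[OF Y AY] by simp
      then have "ad ?Y (ad ?Y A) = 0\<^sub>m n n" using sym Y unfolding ad2_symmetric_def by simp
      then have "?Y * A = 0\<^sub>m n n"
        unfolding ad_ad[OF Y A] YAY AYY YY AY using A Y by (simp add: square_carrier square_zero
          right_mult_zero_mat left_mult_zero_mat)
      then show ?thesis using A N E W by (simp add: square_simps)
    qed
    \<comment> \<open>The normalization \<open>(W N)\<^sub>i\<^sub>j = 1\<close> in \<open>*\<close> is removed by adding a multiple of the identity to \<open>W\<close>.\<close>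
    define c where "c = N $$ (i,j)"
    have c: "c \<noteq> 0" using ij by (simp add: c_def)
    have "N * E * ((1 / c) \<cdot>\<^sub>m 1\<^sub>m n * A) = 0\<^sub>m n n"
      by (rule *) (use N ij c in \<open>simp_all add: square_simps square_entries c_def[symmetric] del: index_mult_mat\<close>)
    then have "(1 / c) \<cdot>\<^sub>m (N * E * A) = 0\<^sub>m n n" using A N E by (simp add: square_simps)
    then have NEA: "N * E * A = 0\<^sub>m n n"
      by (rule smult_cancel[rotated]) (use c A N E in \<open>simp_all add: square_carrier\<close>)
    have "A = 0\<^sub>m n n"
    proof (rule mult_arbitrary_mult_eq_0)
      show "N * E \<in> Mn" using N E by (simp add: square_carrier)
      have "(N * E) $$ (i,i) \<noteq> 0" using ij N by (simp add: E_def mult_munit_entry)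
      then show "N * E \<noteq> 0\<^sub>m n n" using ij by auto
      fix W :: "'a mat" assume W: "W \<in> Mn"
      define s where "s = (1 - (W * N) $$ (i,j)) / c"
      have "N * E * ((W + s \<cdot>\<^sub>m 1\<^sub>m n) * A) = 0\<^sub>m n n"
        by (rule *) (use W N ij c in \<open>simp_all add: square_simps square_entries c_def[symmetric] s_def
            del: index_mult_mat\<close>)
      then have "N * E * W * A + s \<cdot>\<^sub>m (N * E * A) = 0\<^sub>m n n"
        using A N E W by (simp add: square_simps)
      then show "N * E * W * A = 0\<^sub>m n n"
        unfolding NEA using A N E W by (simp add: square_simps)
    qed (rule A)
    then show ?thesis using nz X by (simp add: ad_def)
  next
    case False
    have AA: "A * A \<in> Mn" using A by (simp add: square_carrier)
    obtain i j where ij: "i < n" "j < n" "(A * A) $$ (i,j) \<noteq> 0" using nonzero_entry[OF AA False] .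
    define E :: "'a mat" where "E = munit j i"
    have E: "E \<in> Mn" by (simp add: E_def)
    have EME: "E * M * E = M $$ (i,j) \<cdot>\<^sub>m E" if "M \<in> Mn" for M
      unfolding E_def by (rule munit_mult_munit) (use ij that in auto)
    \<comment> \<open>\<open>a\<close> and \<open>b\<close> solve the triangular system \<open>V\<^sub>i\<^sub>j = (V A)\<^sub>i\<^sub>j = 0\<close>.\<close>
    define c where "c = (A * A) $$ (i,j)"
    define a where "a = - (A $$ (i,j)) / c"
    define b where "b = - ((1\<^sub>m n) $$ (i,j) + a * A $$ (i,j)) / c"
    define V where "V = 1\<^sub>m n + a \<cdot>\<^sub>m A + b \<cdot>\<^sub>m (A * A)"
    have c: "c \<noteq> 0" using ij by (simp add: c_def)
    have V: "V \<in> Mn" using A by (simp add: V_def square_carrier)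
    have VA: "V * A = A + a \<cdot>\<^sub>m (A * A)"
      using A cube unfolding V_def
      by (simp add: square_simps)
    have VAA: "V * A * A = A * A"
      using A cube unfolding VA by (simp add: square_simps)
    have V0: "V $$ (i,j) = 0"
      using A ij c unfolding V_def
      by (simp add: square_carrier square_entries c_def[symmetric] b_def del: index_mult_mat index_one_mat)
    have VA0: "(V * A) $$ (i,j) = 0"
      using A ij c unfolding VA by (simp add: square_carrier square_entries c_def[symmetric] a_def del: index_mult_mat)
    let ?Y = "E * V"
    have Y: "?Y \<in> Mn" using E V by (simp add: square_carrier)
    have YY: "?Y * ?Y = 0\<^sub>m n n"
    proof -
      have "?Y * ?Y = (E * V * E) * V" using E V by (simp add: square_simps)
      also have "\<dots> = 0\<^sub>m n n" unfolding EME[OF V] V0 using E V by (simp add: zero_smult)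
      finally show ?thesis .
    qed
    have YAY: "?Y * A * ?Y = 0\<^sub>m n n"
    proof -
      have "?Y * A * ?Y = (E * (V * A) * E) * V" using A E V by (simp add: square_simps)
      also have "\<dots> = 0\<^sub>m n n"
        unfolding EME[OF mult_carrier_mat[OF V A]] VA0 using E V by (simp add: zero_smult)
      finally show ?thesis .
    qed
    have "ad A (ad A ?Y) = 0\<^sub>m n n"
      using ad_ad_eq_0_if_square_0[OF A Y YY YAY] sym Y unfolding ad2_symmetric_def by simp
    then have "?Y * (A * A * ?Y - 2 \<cdot>\<^sub>m (A * ?Y * A) + ?Y * A * A) = 0\<^sub>m n n"
      unfolding ad_ad[OF A Y] using right_mult_zero_mat[OF Y] by simp
    then have "?Y * A * A * ?Y - 2 \<cdot>\<^sub>m (?Y * A * ?Y * A) + ?Y * ?Y * A * A = 0\<^sub>m n n"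
      using A E V by (simp add: square_simps)
    then have "?Y * A * A * ?Y = 0\<^sub>m n n"
      unfolding YAY YY using A Y by (simp add: square_carrier square_zero
          right_mult_zero_mat left_mult_zero_mat)
    moreover have "?Y * A * A * ?Y = E * (V * A * A) * E * V"
      using A E V by (simp add: square_simps)
    ultimately have "c \<cdot>\<^sub>m ?Y = 0\<^sub>m n n"
      using E V by (simp add: VAA EME[OF AA] c_def[symmetric] square_distrib)
    then have "?Y = 0\<^sub>m n n" by (rule smult_cancel[OF c _ Y])
    moreover have "E * (V * A * A) * E = ?Y * (A * A * E)"
      using A E V by (simp add: square_simps)
    ultimately have "c \<cdot>\<^sub>m E = 0\<^sub>m n n"
      using A E by (simp add: VAA EME[OF AA] c_def[symmetric] square_carrier)
    then have "E = 0\<^sub>m n n" by (rule smult_cancel[OF c _ E])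
    then have "E $$ (j,i) = 0" using ij by simp
    then show ?thesis using ij by (simp add: E_def munit_index)
  qed
qed

text \<open>
  Subtracting a scalar matrix from \<open>A\<close> changes neither the commutators nor the hypothesis, so the
  scalar by which \<open>A\<close> acts on \<open>[X,A]\<close> may be taken to be zero.
\<close>

lemma commute_if_ad_ad_eq_0:
  fixes A X :: "'a :: field_char_0 mat"
  assumes A: "A \<in> Mn" and X: "X \<in> Mn" and sym: "ad2_symmetric A"
    and X2: "ad A (ad A X) = 0\<^sub>m n n"
  shows "ad X A = 0\<^sub>m n n"
proof (rule ccontr)
  assume nz: "ad X A \<noteq> 0\<^sub>m n n"
  obtain c where "ad X A * (A - c \<cdot>\<^sub>m 1\<^sub>m n) = 0\<^sub>m n n" "(A - c \<cdot>\<^sub>m 1\<^sub>m n) * ad X A = 0\<^sub>m n n"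
    using ad2_symmetric_scalar_action[OF A X sym X2 nz] .
  then show False
    using ad2_symmetric_nilpotent_case[OF _ X ad2_symmetric_shift[OF A sym, of c]] A X nz
    by (simp add: ad_shift square_carrier)
qed

text \<open>
  Since \<open>Ann\<^sub>2(Q)\<close> equals a kernel, it is closed under addition, and it contains \<open>Q\<close>. Expanding the
  quadratic condition at \<open>Y + Q\<close> leaves the polarized term \<open>[Q,[Y,Q]]\<close>, which is \<open>-[Q,[Q,Y]]\<close>.
\<close>

lemma ad_ad_eq_0_if_ker_ad_2_eq_Ann_2:
  fixes P Q Y :: "'a :: comm_ring_1 mat"
  assumes P: "P \<in> Mn" and Q: "Q \<in> Mn" and eq: "ker_ad n 2 P = Ann n 2 Q"
    and Y: "Y \<in> Mn" "ad P (ad P Y) = 0\<^sub>m n n"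
  shows "ad Q (ad Q Y) = 0\<^sub>m n n"
proof -
  have iff: "ad P (ad P Z) = 0\<^sub>m n n \<longleftrightarrow> ad Z (ad Z Q) = 0\<^sub>m n n" if "Z \<in> Mn" for Z
    using eq that by (auto simp: ker_ad_def Ann_def set_eq_iff numeral_2_eq_2)
  have "ad Q Q = 0\<^sub>m n n" using Q by (simp add: ad_eq_0_iff)
  then have "ad P (ad P Q) = 0\<^sub>m n n" using iff[of Q] Q ad_pow_zero[of Q 1] by simp
  then have "ad P (ad P (Y + Q)) = 0\<^sub>m n n"
    using ad_pow_add[of P Y Q 2] P Q Y by (simp add: numeral_2_eq_2)
  then have "ad (Y + Q) (ad (Y + Q) Q) = 0\<^sub>m n n" using iff Q Y by (simp add: square_carrier)
  moreover have "ad (Y + Q) (ad (Y + Q) Q) = ad Y (ad Y Q) - ad Q (ad Q Y)"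
    using Q Y(1) unfolding ad_def
    by (intro square_mat_eqI) (simp_all add: square_simps square_entries del: index_mult_mat)
  moreover have "ad Y (ad Y Q) = 0\<^sub>m n n" using iff Y by simp
  ultimately have "0\<^sub>m n n - ad Q (ad Q Y) = 0\<^sub>m n n" by simp
  then show ?thesis using Q Y by (simp add: diff_eq_0_iff square_carrier)
qed

lemma ad_ad_eq_0_iff_commute:
  fixes P Q Y :: "'a :: field_char_0 mat"
  assumes P: "P \<in> Mn" and Q: "Q \<in> Mn"
    and eq: "ker_ad n 2 P = Ann n 2 Q" "ker_ad n 2 Q = Ann n 2 P" and Y: "Y \<in> Mn"
  shows "ad P (ad P Y) = 0\<^sub>m n n \<longleftrightarrow> Y * P = P * Y"
proof
  have "ad2_symmetric P"
    unfolding ad2_symmetric_def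
  proof
    fix Z :: "'a mat" assume Z: "Z \<in> Mn"
    have "ad P (ad P Z) = 0\<^sub>m n n \<longleftrightarrow> ad Q (ad Q Z) = 0\<^sub>m n n"
      using ad_ad_eq_0_if_ker_ad_2_eq_Ann_2[OF P Q eq(1) Z]
        ad_ad_eq_0_if_ker_ad_2_eq_Ann_2[OF Q P eq(2) Z] by blast
    moreover have "ad Q (ad Q Z) = 0\<^sub>m n n \<longleftrightarrow> ad Z (ad Z P) = 0\<^sub>m n n"
      using eq(2) Z by (auto simp: ker_ad_def Ann_def set_eq_iff numeral_2_eq_2)
    ultimately show "ad P (ad P Z) = 0\<^sub>m n n \<longleftrightarrow> ad Z (ad Z P) = 0\<^sub>m n n" by simp
  qed
  then show "ad P (ad P Y) = 0\<^sub>m n n \<Longrightarrow> Y * P = P * Y"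
    using commute_if_ad_ad_eq_0[OF P Y] P Y by (simp add: ad_eq_0_iff)
  show "ad P (ad P Y) = 0\<^sub>m n n" if "Y * P = P * Y"
    using ad_pow_eq_0_if_commute[OF P Y, of 2] that by (simp add: numeral_2_eq_2)
qed

section \<open>Equality of centralizers\<close>

lemma commute_iff_if_equalities:
  fixes A B :: "'a :: field_char_0 mat"
  assumes A: "A \<in> Mn" and B: "B \<in> Mn" and k: "k1 > 0" "k2 > 0"
    and eq1: "ker_ad n k1 A = Ann n k1 B" and eq2: "ker_ad n k2 B = Ann n k2 A" and X: "X \<in> Mn"
  shows "X * A = A * X \<longleftrightarrow> X * B = B * X"
proof -
  have one: "X * P = P * X \<longleftrightarrow> X * Q = Q * X"
    if "P \<in> Mn" "Q \<in> Mn" "ker_ad n 1 P = Ann n 1 Q" for P Q :: "'a mat"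
  proof -
    have "X \<in> ker_ad n 1 P \<longleftrightarrow> X \<in> Ann n 1 Q" using that(3) by simp
    then show ?thesis using that X by (simp add: ker_ad_def Ann_def ad_eq_0_iff eq_commute)
  qed
  have three: "X * P = P * X \<longleftrightarrow> X * Q = Q * X"
    if PQ: "P \<in> Mn" "Q \<in> Mn" and eq: "ker_ad n k P = Ann n k Q" "ker_ad n l Q = Ann n l P"
      and k: "k \<ge> 3" "l > 0" for P Q :: "'a mat" and k l
  proof -
    have cent: "Y * Q = Q * Y" if "Y \<in> Mn" for Y
      by (rule central_if_ker_ad_eq_Ann_ge_3[OF PQ(1,2) eq(1) k(1) that])
    have "ker_ad n l Q = Mn"
      using cent PQ k by (auto simp: ker_ad_def intro!: ad_pow_eq_0_if_commute)
    then have "X * P = P * X" using central_if_Ann_all[of P l X] PQ eq X by simp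
    then show ?thesis using cent X by simp
  qed
  have two: "X * A = A * X \<longleftrightarrow> X * B = B * X"
    if eq: "ker_ad n 2 A = Ann n 2 B" "ker_ad n 2 B = Ann n 2 A"
    using ad_ad_eq_0_iff_commute[OF A B eq X] ad_ad_eq_0_iff_commute[OF B A eq(2,1) X]
      ad_ad_eq_0_if_ker_ad_2_eq_Ann_2[OF A B eq(1) X] ad_ad_eq_0_if_ker_ad_2_eq_Ann_2[OF B A eq(2) X]
    by blast
  consider "k1 = 1" | "k2 = 1" | "k1 \<ge> 3" | "k2 \<ge> 3" | "k1 = 2" "k2 = 2" using k by linarith
  then show ?thesis
    using one[OF A B] one[OF B A] three[OF A B eq1 eq2 _ k(2)] three[OF B A eq2 eq1 _ k(1)] two eq1 eq2
    by cases auto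
qed

section \<open>Polynomials in a matrix\<close>

lemma finsum_mat_entry:
  fixes f :: "'i \<Rightarrow> 'a :: comm_ring_1 mat"
  assumes "finite I" "\<And>i. i \<in> I \<Longrightarrow> f i \<in> Mn"
  shows "finsum (ring_mat TYPE('a) n ()) f I \<in> Mn \<and>
    (\<forall>p<n. \<forall>q<n. finsum (ring_mat TYPE('a) n ()) f I $$ (p,q) = (\<Sum>i\<in>I. f i $$ (p,q)))"
proof -
  interpret R: ring "ring_mat TYPE('a) n ()" by (rule ring_mat)
  show ?thesis
    using assms
  proof (induction I)
    case empty
    then show ?case using R.finsum_empty by (simp add: ring_mat_simps)
  next
    case (insert i I)
    then have "finsum (ring_mat TYPE('a) n ()) f (insert i I) = f i + finsum (ring_mat TYPE('a) n ()) f I"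
      by (subst R.finsum_insert) (auto simp: ring_mat_simps)
    then show ?case using insert by (simp add: square_carrier square_entries)
  qed
qed

lemma mat_poly_eval_carrier [simp]:
  fixes A :: "'a :: comm_ring_1 mat"
  assumes "A \<in> Mn"
  shows "mat_poly_eval n p A \<in> Mn"
  unfolding mat_poly_eval_def using finsum_mat_entry[of "{..degree p}" "\<lambda>i. coeff p i \<cdot>\<^sub>m (A ^\<^sub>m i)"] assms
  by simp

text \<open>
  Any upper bound \<open>m\<close> for the degree is admitted, so that polynomials of different degrees can be
  compared on a common range of summation.
\<close>

lemma mat_poly_eval_entry:
  fixes A :: "'a :: comm_ring_1 mat"
  assumes "A \<in> Mn" "degree p \<le> m" "i < n" "j < n"
  shows "mat_poly_eval n p A $$ (i,j) = (\<Sum>k\<le>m. coeff p k * (A ^\<^sub>m k) $$ (i,j))"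
proof -
  have "mat_poly_eval n p A $$ (i,j) = (\<Sum>k\<le>degree p. coeff p k * (A ^\<^sub>m k) $$ (i,j))"
    unfolding mat_poly_eval_def
    using finsum_mat_entry[of "{..degree p}" "\<lambda>i. coeff p i \<cdot>\<^sub>m (A ^\<^sub>m i)"] assms
    by (simp add: square_entries square_carrier)
  also have "\<dots> = (\<Sum>k\<le>m. coeff p k * (A ^\<^sub>m k) $$ (i,j))"
    by (rule sum.mono_neutral_left) (use assms in \<open>auto intro: le_degree\<close>)
  finally show ?thesis .
qed

lemma mat_poly_eval_one:
  fixes A :: "'a :: comm_ring_1 mat"
  assumes "A \<in> Mn"
  shows "mat_poly_eval n 1 A = 1\<^sub>m n"
  using assms by (intro square_mat_eqI) (auto simp: mat_poly_eval_entry[of _ _ 0])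

lemma mat_poly_eval_add_smult:
  fixes A :: "'a :: comm_ring_1 mat"
  assumes "A \<in> Mn"
  shows "mat_poly_eval n (p + smult c q) A = mat_poly_eval n p A + c \<cdot>\<^sub>m mat_poly_eval n q A"
proof (rule square_mat_eqI)
  let ?m = "max (degree p) (degree q)"
  have "degree (p + smult c q) \<le> ?m"
    by (meson degree_add_le degree_smult_le le_trans max.cobounded1 max.cobounded2)
  then show "mat_poly_eval n (p + smult c q) A $$ (i,j)
      = (mat_poly_eval n p A + c \<cdot>\<^sub>m mat_poly_eval n q A) $$ (i,j)" if "i < n" "j < n" for i j
    using that assms
    by (simp add: square_entries square_carrier mat_poly_eval_entry[of _ _ ?m] sum.distrib
        sum_distrib_left algebra_simps)
qed (use assms in \<open>simp_all add: square_carrier\<close>)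

lemma mat_poly_eval_shift:
  fixes A :: "'a :: comm_ring_1 mat"
  assumes A: "A \<in> Mn"
  shows "mat_poly_eval n (pCons 0 p) A = mat_poly_eval n p A * A"
proof (rule square_mat_eqI)
  fix i j assume ij: "i < n" "j < n"
  have "(mat_poly_eval n p A * A) $$ (i,j)
      = (\<Sum>r<n. \<Sum>k\<le>degree p. coeff p k * ((A ^\<^sub>m k) $$ (i,r) * A $$ (r,j)))"
    using A ij by (simp add: mult_entry mat_poly_eval_entry[of _ _ "degree p"] sum_distrib_right mult.assoc
        del: index_mult_mat)
  also have "\<dots> = (\<Sum>k\<le>degree p. coeff p k * (A ^\<^sub>m k * A) $$ (i,j))"
    using A ij by (subst sum.swap) (simp add: mult_entry sum_distrib_left del: index_mult_mat)
  also have "\<dots> = (\<Sum>k\<le>Suc (degree p). coeff (pCons 0 p) k * (A ^\<^sub>m k) $$ (i,j))"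
    unfolding sum.atMost_Suc_shift by simp
  also have "\<dots> = mat_poly_eval n (pCons 0 p) A $$ (i,j)"
    using A ij degree_pCons_le[of 0 p] by (simp add: mat_poly_eval_entry del: sum.atMost_Suc)
  finally show "mat_poly_eval n (pCons 0 p) A $$ (i,j) = (mat_poly_eval n p A * A) $$ (i,j)" by simp
qed (use A in \<open>simp_all add: square_carrier\<close>)

lemma commute_mat_poly_eval:
  fixes A X :: "'a :: comm_ring_1 mat"
  assumes A: "A \<in> Mn" and X: "X \<in> Mn" and comm: "X * A = A * X"
  shows "X * mat_poly_eval n p A = mat_poly_eval n p A * X"
proof (induction p)
  case 0
  have "mat_poly_eval n 0 A = 0\<^sub>m n n"
    using A by (intro square_mat_eqI) (auto simp: mat_poly_eval_entry[of _ _ 0])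
  then show ?case using X by simp
next
  case (pCons a p)
  have "pCons a p = pCons 0 p + smult a 1" by simp
  then have eq: "mat_poly_eval n (pCons a p) A = mat_poly_eval n p A * A + a \<cdot>\<^sub>m 1\<^sub>m n"
    using A by (simp only: mat_poly_eval_add_smult mat_poly_eval_shift mat_poly_eval_one)
  let ?E = "mat_poly_eval n p A"
  have "X * (?E * A) = X * ?E * A" using A X by (simp add: square_simps)
  also have "\<dots> = ?E * (X * A)" using A X pCons by (simp add: square_simps)
  also have "\<dots> = ?E * A * X" using A X comm by (simp add: square_simps)
  finally show ?case unfolding eq using A X by (simp add: square_simps)
qed

section \<open>The double centralizer property\<close>

lemma sum_fun_eval: "(\<Sum>i\<in>I. f i) b = (\<Sum>i\<in>I. f i b)"
  for f :: "'i \<Rightarrow> 'b \<Rightarrow> 'a :: comm_monoid_add"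
  by (induction I rule: infinite_finite_induct) auto

text \<open>
  Let \<open>x d\<close> be the first member of the sequence that depends linearly on its predecessors. It exists
  since functions on a finite set form a finite-dimensional space. The earlier members are
  independent, so a linear functional can be prescribed on them; \<open>\<phi>\<close> is its coordinate vector.
\<close>

lemma first_dependence_with_functional:
  fixes x :: "nat \<Rightarrow> 'b \<Rightarrow> 'a :: field"
  assumes S: "finite S"
  obtains d a \<phi> where "\<And>b. b \<in> S \<Longrightarrow> x d b = (\<Sum>i<d. a i * x i b)"
    "\<And>i. i < d \<Longrightarrow> (\<Sum>b\<in>S. \<phi> b * x i b) = (if Suc i = d then 1 else 0)"
proof -
  define scale :: "'a \<Rightarrow> ('b \<Rightarrow> 'a) \<Rightarrow> 'b \<Rightarrow> 'a" where "scale c f = (\<lambda>b. c * f b)" for c f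
  interpret vs: vector_space scale
    by unfold_locales (auto simp: scale_def fun_eq_iff algebra_simps)
  interpret vp: vector_space_pair scale "(*) :: 'a \<Rightarrow> 'a \<Rightarrow> 'a"
    by unfold_locales (auto simp: algebra_simps)
  define \<delta> :: "'b \<Rightarrow> 'b \<Rightarrow> 'a" where "\<delta> b = (\<lambda>c. if c = b then 1 else 0)" for b
  \<comment> \<open>Only the values on \<open>S\<close> matter; cutting off outside \<open>S\<close> gives finite dimension.\<close>
  define y where "y i b = (if b \<in> S then x i b else 0)" for i b
  have y_expand: "y i = (\<Sum>b\<in>S. scale (x i b) (\<delta> b))" for i
  proof
    fix c
    have "(\<Sum>b\<in>S. scale (x i b) (\<delta> b)) c = (\<Sum>b\<in>S. if b = c then x i b else 0)"
      unfolding sum_fun_eval by (intro sum.cong) (auto simp: scale_def \<delta>_def)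
    then show "y i c = (\<Sum>b\<in>S. scale (x i b) (\<delta> b)) c"
      using S by (simp add: y_def sum.delta)
  qed
  have indep: "vs.independent (y ` {..<m}) \<and> inj_on y {..<m}"
    if "\<And>i. i < m \<Longrightarrow> y i \<notin> vs.span (y ` {..<i})" for m
    using that
  proof (induction m)
    case (Suc m)
    then have "y m \<notin> vs.span (y ` {..<m})" by simp
    moreover from this have "y m \<notin> y ` {..<m}" using vs.span_superset[of "y ` {..<m}"] by auto
    ultimately show ?case using Suc by (simp add: lessThan_Suc vs.independent_insert)
  qed (simp add: vs.independent_empty)
  have "\<exists>d. y d \<in> vs.span (y ` {..<d})"
  proof (rule ccontr)
    assume "\<not> ?thesis"
    then have *: "vs.independent (y ` {..<m})" "inj_on y {..<m}" for m using indep[of m] by auto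
    have "y i \<in> vs.span (\<delta> ` S)" for i
      unfolding y_expand by (intro vs.span_sum vs.span_scale vs.span_base) auto
    then have "card (y ` {..<Suc (card S)}) \<le> card (\<delta> ` S)"
      using vs.independent_span_bound[OF _ *(1)] S by blast
    also have "\<dots> \<le> card S" using S by (rule card_image_le)
    finally show False using card_image[OF *(2)[of "Suc (card S)"]] by simp
  qed
  then obtain d where d: "y d \<in> vs.span (y ` {..<d})" "\<And>i. i < d \<Longrightarrow> y i \<notin> vs.span (y ` {..<i})"
    using exists_least_iff[of "\<lambda>d. y d \<in> vs.span (y ` {..<d})"] by blast
  then have ind: "vs.independent (y ` {..<d})" and inj: "inj_on y {..<d}" using indep by auto
  obtain u where "y d = (\<Sum>v\<in>y ` {..<d}. scale (u v) v)"
    using d(1) vs.span_finite[of "y ` {..<d}"] by auto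
  also have "\<dots> = (\<Sum>i<d. scale (u (y i)) (y i))" by (simp add: sum.reindex[OF inj])
  finally have u: "y d b = (\<Sum>i<d. u (y i) * y i b)" for b by (simp add: sum_fun_eval scale_def)
  obtain f where f: "Vector_Spaces.linear scale (*) f"
    "\<And>v. v \<in> y ` {..<d} \<Longrightarrow> f v = (if v = y (d - 1) then 1 else 0)"
    using vp.linear_independent_extend[OF ind, of "\<lambda>v. if v = y (d - 1) then 1 else 0"] by blast
  interpret f: Vector_Spaces.linear scale "(*)" f by (rule f(1))
  show ?thesis
  proof
    show "x d b = (\<Sum>i<d. u (y i) * x i b)" if "b \<in> S" for b
      using u[of b] that by (simp add: y_def[of _ b])
    fix i assume i: "i < d"
    have "f (y i) = (\<Sum>b\<in>S. x i b * f (\<delta> b))"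
      unfolding y_expand[of i] f.sum f.scale ..
    moreover have "f (y i) = (if Suc i = d then 1 else 0)"
      using i f(2)[of "y i"] inj_on_eq_iff[OF inj, of i "d - 1"] by auto
    ultimately show "(\<Sum>b\<in>S. f (\<delta> b) * x i b) = (if Suc i = d then 1 else 0)"
      by (simp add: mult.commute)
  qed
qed

text \<open>
  The Horner scheme for the polynomial \<open>x\<^sup>d - a\<^sub>d\<^sub>-\<^sub>1 x\<^sup>d\<^sup>-\<^sup>1 - \<dots> - a\<^sub>0\<close> at \<open>A\<close>, stopped after
  \<open>m\<close> steps; \<open>m = d\<close> gives the value of the polynomial.
\<close>

primrec horner :: "'a :: comm_ring_1 mat \<Rightarrow> (nat \<Rightarrow> 'a) \<Rightarrow> nat \<Rightarrow> nat \<Rightarrow> 'a mat" where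
  "horner A a d 0 = 1\<^sub>m n"
| "horner A a d (Suc m) = horner A a d m * A - a (d - Suc m) \<cdot>\<^sub>m 1\<^sub>m n"

lemma horner_poly:
  fixes A :: "'a :: comm_ring_1 mat"
  assumes "A \<in> Mn"
  shows "\<exists>p. horner A a d m = mat_poly_eval n p A"
proof (induction m)
  case 0
  then show ?case using mat_poly_eval_one[OF assms] by (metis horner.simps(1))
next
  case (Suc m)
  then obtain p where p: "horner A a d m = mat_poly_eval n p A" by blast
  have "horner A a d (Suc m) = mat_poly_eval n (pCons 0 p + smult (- a (d - Suc m)) 1) A"
    using assms p unfolding mat_poly_eval_add_smult[OF assms] mat_poly_eval_shift[OF assms]
      mat_poly_eval_one[OF assms]
    by (intro square_mat_eqI) (simp_all add: square_carrier square_entries del: index_mult_mat)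
  then show ?case by blast
qed

lemma horner_carrier [simp]: "A \<in> Mn \<Longrightarrow> horner A a d m \<in> Mn"
  for A :: "'a :: comm_ring_1 mat"
  using horner_poly[of A a d m] by auto

lemma horner_closed:
  fixes A :: "'a :: comm_ring_1 mat"
  assumes A: "A \<in> Mn" and "m \<le> d" "p < n" "q < n"
  shows "horner A a d m $$ (p,q) = (A ^\<^sub>m m) $$ (p,q) - (\<Sum>j<m. a (d - m + j) * (A ^\<^sub>m j) $$ (p,q))"
  using assms(2-)
proof (induction m arbitrary: p q)
  case 0
  then show ?case using A by simp
next
  case (Suc m)
  have "(horner A a d m * A) $$ (p,q)
      = (\<Sum>r<n. (A ^\<^sub>m m) $$ (p,r) * A $$ (r,q) - (\<Sum>j<m. a (d - m + j) * ((A ^\<^sub>m j) $$ (p,r) * A $$ (r,q))))"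
    using A Suc by (simp add: mult_entry left_diff_distrib sum_distrib_right mult.assoc del: index_mult_mat)
  also have "\<dots> = (A ^\<^sub>m m * A) $$ (p,q) - (\<Sum>j<m. a (d - m + j) * (A ^\<^sub>m j * A) $$ (p,q))"
    using A Suc.prems by (simp add: sum_subtractf sum.swap[of _ "{..<n}"] mult_entry sum_distrib_left del: index_mult_mat)
  finally have 1: "(horner A a d m * A) $$ (p,q)
    = (A ^\<^sub>m Suc m) $$ (p,q) - (\<Sum>j<m. a (d - m + j) * (A ^\<^sub>m Suc j) $$ (p,q))" by simp
  have "(\<Sum>j<Suc m. a (d - Suc m + j) * (A ^\<^sub>m j) $$ (p,q))
    = a (d - Suc m) * 1\<^sub>m n $$ (p,q) + (\<Sum>j<m. a (d - m + j) * (A ^\<^sub>m Suc j) $$ (p,q))"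
  proof -
    have idx: "d - Suc m + Suc j = d - m + j" for j using Suc.prems by simp
    show ?thesis using A unfolding sum.lessThan_Suc_shift idx by simp
  qed
  then show ?case using A Suc.prems 1
    by (simp add: square_entries square_carrier del: index_mult_mat pow_mat.simps sum.lessThan_Suc index_one_mat)
qed

text \<open>
  Let \<open>m(x) = x\<^sup>d - \<Sum>i<d. a\<^sub>i x\<^sup>i\<close> be the minimal polynomial of \<open>A\<close> and let \<open>h\<^sub>i\<close> be its Horner
  tails at \<open>A\<close>: \<open>h\<^sub>d = 1\<close>, \<open>A h\<^sub>i\<^sub>+\<^sub>1 = h\<^sub>i + a\<^sub>i\<close>, \<open>h\<^sub>0 = m(A) = 0\<close>. The sum
  \<open>\<Sum>i<d. h\<^sub>i\<^sub>+\<^sub>1 \<otimes> A\<^sup>i\<close> is the value of \<open>(m(x) - m(y)) / (x - y)\<close> at \<open>A \<otimes> 1\<close> and \<open>1 \<otimes> A\<close>, and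
  therefore \<open>T = \<Sum>i<d. h\<^sub>i\<^sub>+\<^sub>1 Z A\<^sup>i\<close> commutes with \<open>A\<close> for every matrix \<open>Z\<close>. By hypothesis \<open>T\<close>
  commutes with \<open>B\<close>; with \<open>Z\<close> running over the matrix units, this says
  \<open>\<Sum>i<d. B h\<^sub>i\<^sub>+\<^sub>1 \<otimes> A\<^sup>i = \<Sum>i<d. h\<^sub>i\<^sub>+\<^sub>1 \<otimes> A\<^sup>i B\<close>. Applying to the
  right tensor factor a linear functional \<open>\<phi>\<close> with \<open>\<phi>(A\<^sup>i) = 0\<close> for \<open>i < d - 1\<close> and \<open>\<phi>(A\<^sup>d\<^sup>-\<^sup>1) = 1\<close> leaves \<open>B\<close> on the left-hand side,
  because \<open>h\<^sub>d = 1\<close>, and a polynomial in \<open>A\<close> on the right-hand side.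
\<close>

lemma double_centralizer:
  fixes A B :: "'a :: field mat"
  assumes A: "A \<in> Mn" and B: "B \<in> Mn"
    and comm: "\<And>X. X \<in> Mn \<Longrightarrow> X * A = A * X \<Longrightarrow> X * B = B * X"
  shows "\<exists>p. B = mat_poly_eval n p A"
proof -
  let ?S = "{..<n} \<times> {..<n}"
  obtain d a \<phi> where dep: "\<And>b. b \<in> ?S \<Longrightarrow> (A ^\<^sub>m d) $$ b = (\<Sum>i<d. a i * (A ^\<^sub>m i) $$ b)"
    and \<phi>: "\<And>i. i < d \<Longrightarrow> (\<Sum>b\<in>?S. \<phi> b * (A ^\<^sub>m i) $$ b) = (if Suc i = d then 1 else 0)"
    using first_dependence_with_functional[of ?S "\<lambda>i b. (A ^\<^sub>m i) $$ b"] by blast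
  define h where "h i = horner A a d (d - i)" for i
  have h: "h i \<in> Mn" for i using A by (simp add: h_def)
  have hd: "h d = 1\<^sub>m n" by (simp add: h_def)
  have h0: "h 0 = 0\<^sub>m n n"
    using h[of 0] horner_closed[OF A order_refl] dep by (intro square_mat_eqI) (auto simp: h_def)
  have h_step: "A * h (Suc i) = h i + a i \<cdot>\<^sub>m 1\<^sub>m n" if "i < d" for i
  proof -
    obtain p where p: "h (Suc i) = mat_poly_eval n p A" using horner_poly[OF A] h_def by metis
    have "A * h (Suc i) = h (Suc i) * A" unfolding p by (rule commute_mat_poly_eval) (use A in auto)
    moreover have "d - i = Suc (d - Suc i)" "d - Suc (d - Suc i) = i" using that by auto
    then have "h i = h (Suc i) * A - a i \<cdot>\<^sub>m 1\<^sub>m n" by (simp add: h_def)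
    ultimately show ?thesis using A h[of "Suc i"]
      by (intro square_mat_eqI) (simp_all add: square_carrier square_entries del: index_mult_mat)
  qed
  have key: "(\<Sum>i<d. (B * h (Suc i)) $$ (p,j) * (A ^\<^sub>m i) $$ (k,q))
      = (\<Sum>i<d. h (Suc i) $$ (p,j) * (A ^\<^sub>m i * B) $$ (k,q))"
    if lt: "p < n" "q < n" "j < n" "k < n" for p q j k
  proof -
    \<comment> \<open>the matrix \<open>T\<close> for \<open>Z\<close> the matrix unit with entry \<open>1\<close> at position \<open>(j,k)\<close>\<close>
    define T where "T = mat n n (\<lambda>(p,q). \<Sum>i<d. h (Suc i) $$ (p,j) * (A ^\<^sub>m i) $$ (k,q))"
    have T: "T \<in> Mn" by (simp add: T_def)
    have left: "(M * T) $$ (p,q) = (\<Sum>i<d. (M * h (Suc i)) $$ (p,j) * (A ^\<^sub>m i) $$ (k,q))"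
      if "M \<in> Mn" "p < n" "q < n" for M p q
    proof -
      have "(M * T) $$ (p,q) = (\<Sum>r<n. \<Sum>i<d. M $$ (p,r) * h (Suc i) $$ (r,j) * (A ^\<^sub>m i) $$ (k,q))"
        using that T by (simp add: mult_entry T_def sum_distrib_left mult.assoc del: index_mult_mat)
      also have "\<dots> = (\<Sum>i<d. (M * h (Suc i)) $$ (p,j) * (A ^\<^sub>m i) $$ (k,q))"
        using that lt h by (subst sum.swap) (simp add: mult_entry sum_distrib_right del: index_mult_mat)
      finally show ?thesis .
    qed
    have right: "(T * M) $$ (p,q) = (\<Sum>i<d. h (Suc i) $$ (p,j) * (A ^\<^sub>m i * M) $$ (k,q))"
      if "M \<in> Mn" "p < n" "q < n" for M p q
    proof -
      have "(T * M) $$ (p,q) = (\<Sum>r<n. \<Sum>i<d. h (Suc i) $$ (p,j) * ((A ^\<^sub>m i) $$ (k,r) * M $$ (r,q)))"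
        using that T by (simp add: mult_entry T_def sum_distrib_right mult.assoc del: index_mult_mat)
      also have "\<dots> = (\<Sum>i<d. h (Suc i) $$ (p,j) * (A ^\<^sub>m i * M) $$ (k,q))"
        using that lt A by (subst sum.swap) (simp add: mult_entry sum_distrib_left del: index_mult_mat)
      finally show ?thesis .
    qed
    have "T * A = A * T"
    proof (rule square_mat_eqI)
      fix p q assume pq: "p < n" "q < n"
      let ?F = "\<lambda>i. h i $$ (p,j) * (A ^\<^sub>m i) $$ (k,q)"
      have "(A * T) $$ (p,q) = (\<Sum>i<d. ?F i + 1\<^sub>m n $$ (p,j) * (a i * (A ^\<^sub>m i) $$ (k,q)))"
        unfolding left[OF A pq]
        by (rule sum.cong) (use h pq lt in \<open>simp_all add: h_step square_entries square_carrier algebra_simps\<close>)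
      also have "\<dots> = (\<Sum>i<d. ?F i) + 1\<^sub>m n $$ (p,j) * (A ^\<^sub>m d) $$ (k,q)"
        using dep[of "(k,q)"] lt pq by (simp add: sum.distrib sum_distrib_left)
      also have "\<dots> = (\<Sum>i<d. ?F i) + ?F d" by (simp add: hd)
      also have "\<dots> = (\<Sum>i<Suc d. ?F i)" by simp
      also have "\<dots> = ?F 0 + (\<Sum>i<d. ?F (Suc i))" by (rule sum.lessThan_Suc_shift)
      also have "?F 0 = 0" using h0 pq lt by simp
      finally show "(T * A) $$ (p,q) = (A * T) $$ (p,q)" unfolding right[OF A pq] by simp
    qed (use A T in \<open>simp_all add: square_carrier\<close>)
    then have "T * B = B * T" by (rule comm[OF T])
    then show ?thesis using left[OF B lt(1,2)] right[OF B lt(1,2)] by simp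
  qed
  define c where "c i = (\<Sum>b\<in>?S. \<phi> b * (A ^\<^sub>m i * B) $$ b)" for i
  have B_entry: "B $$ (p,j) = (\<Sum>i<d. c i * h (Suc i) $$ (p,j))" if lt: "p < n" "j < n" for p j
  proof -
    have "(\<Sum>i<d. c i * h (Suc i) $$ (p,j))
        = (\<Sum>b\<in>?S. \<phi> b * (\<Sum>i<d. h (Suc i) $$ (p,j) * (A ^\<^sub>m i * B) $$ b))"
      unfolding c_def sum_distrib_left sum_distrib_right
      by (subst sum.swap) (simp add: mult_ac)
    also have "\<dots> = (\<Sum>b\<in>?S. \<phi> b * (\<Sum>i<d. (B * h (Suc i)) $$ (p,j) * (A ^\<^sub>m i) $$ b))"
      by (rule sum.cong) (use key lt in auto)
    also have "\<dots> = (\<Sum>i<d. (B * h (Suc i)) $$ (p,j) * (\<Sum>b\<in>?S. \<phi> b * (A ^\<^sub>m i) $$ b))"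
      unfolding sum_distrib_left by (subst sum.swap) (simp add: mult_ac)
    also have "\<dots> = (\<Sum>i<d. if Suc i = d then B $$ (p,j) else 0)"
      by (rule sum.cong) (use \<phi> hd B in auto)
    also have "\<dots> = (if d = 0 then 0 else B $$ (p,j))" by (cases d) simp_all
    also have "\<dots> = B $$ (p,j)"
    proof (cases "d = 0")
      case True
      \<comment> \<open>Here \<open>1 = h\<^sub>d = h\<^sub>0 = 0\<close>, which is impossible for matrices that have an entry.\<close>
      then have "(1\<^sub>m n :: 'a mat) $$ (p,p) = (0\<^sub>m n n) $$ (p,p)" using hd h0 by simp
      then show ?thesis using lt by simp
    qed simp
    finally show ?thesis by simp
  qed
  have "\<exists>p. \<forall>i<n. \<forall>j<n. mat_poly_eval n p A $$ (i,j) = (\<Sum>l<m. c l * h (Suc l) $$ (i,j))" for m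
  proof (induction m)
    case 0
    show ?case by (rule exI[of _ 0]) (use A in \<open>simp add: mat_poly_eval_entry[of _ _ 0]\<close>)
  next
    case (Suc m)
    then obtain p where p: "\<forall>i<n. \<forall>j<n. mat_poly_eval n p A $$ (i,j)
      = (\<Sum>l<m. c l * h (Suc l) $$ (i,j))" ..
    obtain q where q: "h (Suc m) = mat_poly_eval n q A" using horner_poly[OF A] h_def by metis
    show ?case
      by (rule exI[of _ "p + smult (c m) q"])
        (use A p q in \<open>simp add: mat_poly_eval_add_smult square_entries square_carrier\<close>)
  qed
  then obtain p where "\<forall>i<n. \<forall>j<n. mat_poly_eval n p A $$ (i,j)
    = (\<Sum>l<d. c l * h (Suc l) $$ (i,j))" by blast
  then have "B = mat_poly_eval n p A"
    using A B B_entry by (intro square_mat_eqI) auto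
  then show ?thesis ..
qed

end

section \<open>Polynomial equivalence\<close>

theorem theorem4p1:
  fixes A B :: "'a :: field_char_0 mat" and n :: nat
  assumes "A \<in> carrier_mat n n" and "B \<in> carrier_mat n n"
  shows "(\<exists>k1 k2 :: nat. k1 > 0 \<and> k2 > 0 \<and>
            ker_ad n k1 A = Ann n k1 B \<and> ker_ad n k2 B = Ann n k2 A)
         \<longleftrightarrow> poly_equivalent n A B"
proof
  assume "\<exists>k1 k2 :: nat. k1 > 0 \<and> k2 > 0 \<and>
            ker_ad n k1 A = Ann n k1 B \<and> ker_ad n k2 B = Ann n k2 A"
  then obtain k1 k2 where "k1 > 0" "k2 > 0" "ker_ad n k1 A = Ann n k1 B" "ker_ad n k2 B = Ann n k2 A"
    by blast
  then have "X * A = A * X \<longleftrightarrow> X * B = B * X" if "X \<in> carrier_mat n n" for X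
    using commute_iff_if_equalities[OF assms] that by blast
  then show "poly_equivalent n A B"
    unfolding poly_equivalent_def
    using double_centralizer[OF assms] double_centralizer[OF assms(2,1)] by blast
next
  assume "poly_equivalent n A B"
  then obtain f g where fg: "A = mat_poly_eval n f B" "B = mat_poly_eval n g A"
    unfolding poly_equivalent_def by blast
  have iff: "X * A = A * X \<longleftrightarrow> X * B = B * X" if "X \<in> carrier_mat n n" for X
    using commute_mat_poly_eval[OF assms(1) that, of g] commute_mat_poly_eval[OF assms(2) that, of f]
    by (metis fg)
  have "ker_ad n 1 A = Ann n 1 B" "ker_ad n 1 B = Ann n 1 A"
    using assms iff by (auto simp: ker_ad_def Ann_def ad_eq_0_iff eq_commute)
  then show "\<exists>k1 k2 :: nat. k1 > 0 \<and> k2 > 0 \<and>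
            ker_ad n k1 A = Ann n k1 B \<and> ker_ad n k2 B = Ann n k2 A"
    by (intro exI[of _ 1]) simp
qed

end
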